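(* Let $m$ and $F$ be positive integers such that $m<F$ and $m\nmid F$. If $S\in\mathscr{R}(F,m)$, then $\mathscr{R}(F,m)\mathrm{rank}(S)\le m-2$.
   Context: A numerical semigroup is a submonoid $S$ of $(\mathbb{N},+)$ ($\mathbb{N}$ the nonnegative integers) with $\mathbb{N}\setminus S$ finite. Its Frobenius number $\mathrm{F}(S)$ is the largest integer not in $S$, and its multiplicity is $\mathrm{m}(S)=\min(S\setminus\{0\})$. $\mathscr{R}(F,m)$ denotes the set of numerical semigroups $S$ with $\mathrm{F}(S)=F$ and $\mathrm{m}(S)=m$. It is closed under intersection and its minimum with respect to inclusion is $\Delta(F,m)=\langle m\rangle\cup\{n\in\mathbb{N}\mid n\ge F+1\}$, where $\langle m\rangle$ is the set of nonnegative multiples of $m$. A set $X$ is an $\mathscr{R}(F,m)$-set if $X\cap\Delta(F,m)=\emptyset$ and there is $S\in\mathscr{R}(F,m)$ with $X\subseteq S$. For such $X$, $\mathscr{R}(F,m)[X]$ denotes the intersection of all elements of $\mathscr{R}(F,m)$ containing $X$ (it is the smallest element of $\mathscr{R}(F,m)$ containing $X$). For $S\in\mathscr{R}(F,m)$, the $\mathscr{R}(F,m)$-rank of $S$ is $\mathscr{R}(F,m)\mathrm{rank}(S)=\min\{\sharp X\mid X\text{ is an }\mathscr{R}(F,m)\text{-set and }\mathscr{R}(F,m)[X]=S\}$, where $\sharp X$ is the cardinality of $X$. *)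

theory Defs
  imports Main
begin

definition numerical_semigroup :: "nat set \<Rightarrow> bool" where
  "numerical_semigroup S \<longleftrightarrow>
     0 \<in> S \<and> (\<forall>a\<in>S. \<forall>b\<in>S. a + b \<in> S) \<and> finite (UNIV - S)"

text \<open>The Frobenius number is the largest \<^emph>\<open>integer\<close> outside \<open>S\<close>; it is \<open>-1\<close> when \<open>S\<close> is
  the whole of the naturals, hence the integer type.\<close>

definition Frobenius :: "nat set \<Rightarrow> int" where
  "Frobenius S = (GREATEST z. z \<notin> int ` S)"

definition ns_mult :: "nat set \<Rightarrow> nat" where
  "ns_mult S = (LEAST n. n \<in> S - {0})"

definition \<R> :: "nat \<Rightarrow> nat \<Rightarrow> nat set set" where
  "\<R> F m = {S. numerical_semigroup S \<and> Frobenius S = int F \<and> ns_mult S = m}"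

definition \<Delta> :: "nat \<Rightarrow> nat \<Rightarrow> nat set" where
  "\<Delta> F m = {k * m | k. True} \<union> {n. n \<ge> F + 1}"

definition R_set :: "nat \<Rightarrow> nat \<Rightarrow> nat set \<Rightarrow> bool" where
  "R_set F m X \<longleftrightarrow> X \<inter> \<Delta> F m = {} \<and> (\<exists>S\<in>\<R> F m. X \<subseteq> S)"

definition R_gen :: "nat \<Rightarrow> nat \<Rightarrow> nat set \<Rightarrow> nat set" where
  "R_gen F m X = \<Inter>{S \<in> \<R> F m. X \<subseteq> S}"

text \<open>Every \<open>X\<close> with \<open>R_set F m X\<close> is finite, being disjoint from the cofinite set \<open>\<Delta> F m\<close>, so
  \<^const>\<open>card\<close> is its true cardinality. For \<open>S \<in> \<R> F m\<close> the minimum is over a nonempty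
  set, since \<open>X = S - \<Delta> F m\<close> generates \<open>S\<close>.\<close>

definition R_rank :: "nat \<Rightarrow> nat \<Rightarrow> nat set \<Rightarrow> nat" where
  "R_rank F m S = (LEAST k. \<exists>X. R_set F m X \<and> R_gen F m X = S \<and> card X = k)"

end

theory Submission
  imports Defs
begin

text \<open>
  Since \<open>m \<in> S\<close>, the part of \<open>S\<close> in a residue class modulo \<open>m\<close> consists of the numbers
  obtained from its least element by adding multiples of \<open>m\<close>. Hence \<open>S\<close> is generated over
  \<open>\<Delta> F m\<close> by the least elements of the nonzero classes, and only those below \<open>F\<close> matter
  because everything above \<open>F\<close> already lies in \<open>\<Delta> F m\<close>. That would give at most \<open>m - 1\<close>
  generators, one for each nonzero class. The class of \<open>F\<close> is itself nonzero, as \<open>m\<close> does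
  not divide \<open>F\<close>, and it contributes no generator: an element of \<open>S\<close> below \<open>F\<close> in that class
  would force \<open>F \<in> S\<close>. So at most \<open>m - 2\<close> generators remain.
\<close>

text \<open>A \<open>GREATEST\<close> over the integers is meaningful only for a nonempty set bounded above. Here
  finiteness of the gaps gives the bound and \<open>-1\<close> is always a member.\<close>

lemma Frobenius_eq_imp:
  assumes "numerical_semigroup S" and F: "Frobenius S = int F"
  shows "F \<notin> S" and "F < n \<Longrightarrow> n \<in> S"
proof -
  define P where "P = (\<lambda>z. z \<notin> int ` S)"
  obtain b where b: "\<And>n. n \<in> UNIV - S \<Longrightarrow> n \<le> b"
    using assms(1) unfolding numerical_semigroup_def by (meson finite_nat_set_iff_bounded_le)
  have bound: "z \<le> int b" if "P z" for z
  proof (cases "z \<ge> 0")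
    case True
    then have "z = int (nat z)" by simp
    with that have "nat z \<in> UNIV - S" unfolding P_def by (metis DiffI UNIV_I imageI)
    with b True show ?thesis by (metis nat_le_iff)
  qed simp
  have "finite {z. P z \<and> - 1 \<le> z}"
    by (rule finite_subset[of _ "{-1..int b}"]) (auto dest: bound)
  moreover have "P (- 1)" unfolding P_def by auto
  ultimately have max: "P (Max {z. P z \<and> - 1 \<le> z})"
      "\<And>z. P z \<Longrightarrow> z \<le> Max {z. P z \<and> - 1 \<le> z}"
    using Max_in[of "{z. P z \<and> - 1 \<le> z}"] Max_ge[of "{z. P z \<and> - 1 \<le> z}"]
    by (blast, smt (verit) mem_Collect_eq)
  then have "Frobenius S = Max {z. P z \<and> - 1 \<le> z}"
    unfolding Frobenius_def P_def[symmetric] by (intro Greatest_equality) (auto simp: P_def)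
  with F max have "P (int F)" and greatest: "\<And>z. P z \<Longrightarrow> z \<le> int F" by simp_all
  then show "F \<notin> S" unfolding P_def by blast
  show "n \<in> S" if "F < n" using greatest[of "int n"] that unfolding P_def by force
qed

lemma \<R>_D:
  assumes "S \<in> \<R> F m"
  shows "0 \<in> S" and "\<And>a b. a \<in> S \<Longrightarrow> b \<in> S \<Longrightarrow> a + b \<in> S"
    and "F \<notin> S" and "\<And>n. F < n \<Longrightarrow> n \<in> S" and "m \<in> S"
proof -
  have S: "numerical_semigroup S" "Frobenius S = int F" and m: "ns_mult S = m"
    using assms unfolding \<R>_def by auto
  show "0 \<in> S" and "\<And>a b. a \<in> S \<Longrightarrow> b \<in> S \<Longrightarrow> a + b \<in> S"
    using S(1) unfolding numerical_semigroup_def by auto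
  show "F \<notin> S" and above: "\<And>n. F < n \<Longrightarrow> n \<in> S" using Frobenius_eq_imp[OF S] by auto
  have "Suc F \<in> S - {0}" using above by simp
  then show "m \<in> S" using m unfolding ns_mult_def by (metis DiffD1 LeastI)
qed

lemma \<R>_add_mult:
  assumes "S \<in> \<R> F m" "a \<in> S"
  shows "a + k * m \<in> S"
proof (induction k)
  case 0
  then show ?case using assms by simp
next
  case (Suc k)
  have "a + Suc k * m = (a + k * m) + m" by simp
  then show ?case using \<R>_D(2)[OF assms(1) Suc \<R>_D(5)[OF assms(1)]] by metis
qed

lemma \<R>_mod_closed:
  assumes "S \<in> \<R> F m" "a \<in> S" "a \<le> n" "a mod m = n mod m"
  shows "n \<in> S"
proof -
  have "m dvd n - a" using assms(3,4) by (metis mod_eq_dvd_iff_nat)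
  then obtain k where "n = a + k * m" using assms(3)
    by (metis dvd_def le_add_diff_inverse mult.commute)
  then show ?thesis using \<R>_add_mult[OF assms(1,2)] by simp
qed

text \<open>Without the bound by \<open>F\<close>, this is the Apery set of \<open>S\<close> with respect to \<open>m\<close> with its
  element \<open>0\<close> removed. The bound makes it disjoint from \<open>\<Delta> F m\<close>.\<close>

definition small_Apery :: "nat \<Rightarrow> nat \<Rightarrow> nat set \<Rightarrow> nat set" where
  "small_Apery F m S =
     {s \<in> S. s < F \<and> \<not> m dvd s \<and> (\<forall>t\<in>S. t mod m = s mod m \<longrightarrow> s \<le> t)}"

lemma R_set_small_Apery:
  assumes "S \<in> \<R> F m"
  shows "R_set F m (small_Apery F m S)"
  using assms unfolding R_set_def small_Apery_def \<Delta>_def by auto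

text \<open>Any \<open>T \<in> \<R> F m\<close> contains the multiples of \<open>m\<close> and all numbers above \<open>F\<close>. Every other
  element of \<open>S\<close> is the least element of its class plus a multiple of \<open>m\<close>, so it is in \<open>T\<close>
  as soon as that least element is.\<close>

lemma R_gen_small_Apery:
  assumes S: "S \<in> \<R> F m"
  shows "R_gen F m (small_Apery F m S) = S"
proof
  show "R_gen F m (small_Apery F m S) \<subseteq> S"
    using S unfolding R_gen_def small_Apery_def by auto
  have "s \<in> T" if T: "T \<in> \<R> F m" "small_Apery F m S \<subseteq> T" and s: "s \<in> S" for s T
  proof -
    have "s \<noteq> F" using \<R>_D(3)[OF S] s by auto
    then consider "F < s" | "m dvd s" | "s < F" "\<not> m dvd s" by linarith
    then show ?thesis
    proof cases
      case 1
      then show ?thesis using \<R>_D(4)[OF T(1)] by simp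
    next
      case 2
      then show ?thesis using \<R>_mod_closed[OF T(1) \<R>_D(1)[OF T(1)]] by auto
    next
      case 3
      define w where "w = (LEAST t. t \<in> S \<and> t mod m = s mod m)"
      have w: "w \<in> S \<and> w mod m = s mod m"
        unfolding w_def by (rule LeastI[of _ s]) (use s in simp)
      have least: "w \<le> t" if "t \<in> S" "t mod m = s mod m" for t
        unfolding w_def by (rule Least_le) (use that in simp)
      have "\<not> m dvd w" using w 3 by (simp add: dvd_eq_mod_eq_0)
      moreover have "w \<le> s" using least s by simp
      ultimately have "w \<in> small_Apery F m S"
        using w least 3 unfolding small_Apery_def by auto
      with T(2) have "w \<in> T" by auto
      then show ?thesis using \<R>_mod_closed[OF T(1)] w \<open>w \<le> s\<close> by blast
    qed
  qed
  then show "S \<subseteq> R_gen F m (small_Apery F m S)" unfolding R_gen_def by auto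
qed

text \<open>Reduction modulo \<open>m\<close> is injective on these generators and misses both \<open>0\<close> and the class
  of \<open>F\<close>; the two are different exactly because \<open>m\<close> does not divide \<open>F\<close>.\<close>

lemma card_small_Apery:
  assumes S: "S \<in> \<R> F m" and "0 < m" and "\<not> m dvd F"
  shows "card (small_Apery F m S) \<le> m - 2"
proof -
  have "inj_on (\<lambda>s. s mod m) (small_Apery F m S)"
    by (rule inj_onI) (auto simp: small_Apery_def intro: le_antisym)
  moreover have "(\<lambda>s. s mod m) ` small_Apery F m S \<subseteq> {..<m} - {0, F mod m}"
  proof (rule image_subsetI)
    fix s assume s: "s \<in> small_Apery F m S"
    have "s mod m \<noteq> 0" using s unfolding small_Apery_def by (simp add: dvd_eq_mod_eq_0)
    moreover have "s mod m \<noteq> F mod m"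
      using \<R>_mod_closed[OF S, of s F] \<R>_D(3)[OF S] s unfolding small_Apery_def by auto
    ultimately show "s mod m \<in> {..<m} - {0, F mod m}" using assms(2) by simp
  qed
  ultimately have "card (small_Apery F m S) \<le> card ({..<m} - {0, F mod m})"
    by (rule card_inj_on_le) simp
  also have "\<dots> = m - 2"
    using assms by (subst card_Diff_subset) (auto simp: dvd_eq_mod_eq_0)
  finally show ?thesis .
qed

theorem proposition6p3:
  fixes m F :: nat and S :: "nat set"
  assumes "0 < m" and "0 < F" and "m < F" and "\<not> m dvd F"
    and "S \<in> \<R> F m"
  shows "int (R_rank F m S) \<le> int m - 2"
proof -
  have "R_rank F m S \<le> card (small_Apery F m S)"
    unfolding R_rank_def using R_set_small_Apery R_gen_small_Apery assms(5)
    by (intro Least_le) blast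
  also have "\<dots> \<le> m - 2" using card_small_Apery assms by blast
  finally have "R_rank F m S \<le> m - 2" .
  \<comment> \<open>Natural-number subtraction does not truncate here: \<open>m = 1\<close> would divide \<open>F\<close>.\<close>
  moreover have "2 \<le> m" using assms(1,4) by (cases "m = 1") auto
  ultimately show ?thesis by linarith
qed

end
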